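(* In the following setting, suppose it is known that $T$ is convex. Then the perimeter length $L(T)$ and the area $|T|$ are observable, and no other parameter of $T$ (i.e., no quantity not determined by $L(T)$ and $|T|$) is observable. Setting: $\Omega\subset\mathbb{R}^2$ has finite area $|\Omega|$, $T\subset\Omega$ is a polygon, $r_{max}>0$, and every point within distance $r_{max}$ of $T$ lies in $\Omega$; a sensor at a location uniform in $\Omega$ with independent direction $\theta$ uniform in $[0,2\pi)$ reports $s=\min\{t\in[0,r_{max}]:(x+t\cos\theta,y+t\sin\theta)\in T\}$, or no detection if this set is empty.
   Context: Observability: write $\Pr(s\le r\mid\rho,\rho')$ for the distribution function of the measured distance when the target's parameter vectors are $\rho$ and $\rho'$. The parameter vector $\rho$ is observable if and only if there exists a finite set of values $\{\Pr(s\le s_i\mid\rho,\rho')\}_i$ that uniquely determines $\rho$. *)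

theory Defs
  imports "HOL-Probability.Probability"
begin

definition convex_polygon :: "(real \<times> real) set \<Rightarrow> bool" where
  "convex_polygon T \<longleftrightarrow> polytope T \<and> interior T \<noteq> {}"

definition perimeter :: "(real \<times> real) set \<Rightarrow> real" where
  "perimeter T = (\<Sum>E\<in>{E. E face_of T \<and> aff_dim E = 1}. diameter E)"

definition area :: "(real \<times> real) set \<Rightarrow> real" where
  "area T = measure lebesgue T"

definition sensor_space :: "(real \<times> real) set \<Rightarrow> ((real \<times> real) \<times> real) measure" where
  "sensor_space \<Omega> = uniform_measure (lebesgue \<Otimes>\<^sub>M lborel) (\<Omega> \<times> {0..<2*pi})"

definition hit_times :: "real \<Rightarrow> (real \<times> real) set \<Rightarrow> real \<times> real \<Rightarrow> real \<Rightarrow> real set" where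
  "hit_times rmax T p \<theta> = {t \<in> {0..rmax}. (fst p + t * cos \<theta>, snd p + t * sin \<theta>) \<in> T}"

definition dist_fun :: "(real \<times> real) set \<Rightarrow> real \<Rightarrow> (real \<times> real) set \<Rightarrow> real \<Rightarrow> real" where
  "dist_fun \<Omega> rmax T r = measure (sensor_space \<Omega>)
     {(p, \<theta>). hit_times rmax T p \<theta> \<noteq> {} \<and> Inf (hit_times rmax T p \<theta>) \<le> r}"

definition admissible_target :: "(real \<times> real) set \<Rightarrow> real \<Rightarrow> (real \<times> real) set \<Rightarrow> bool" where
  "admissible_target \<Omega> rmax T \<longleftrightarrow> convex_polygon T \<and> T \<subseteq> \<Omega> \<and>
     {q. infdist q T \<le> rmax} \<subseteq> \<Omega>"

definition observable :: "(real \<times> real) set \<Rightarrow> real \<Rightarrow> (real \<times> real) set set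
     \<Rightarrow> ((real \<times> real) set \<Rightarrow> 'b) \<Rightarrow> bool" where
  "observable \<Omega> rmax C f \<longleftrightarrow> (\<exists>S. finite S \<and> (\<forall>T1\<in>C. \<forall>T2\<in>C.
      (\<forall>r\<in>S. dist_fun \<Omega> rmax T1 r = dist_fun \<Omega> rmax T2 r) \<longrightarrow> f T1 = f T2))"

end

theory Submission
  imports Defs
begin

text \<open>
  For a fixed direction \<open>u\<close>, the sensor positions that detect \<open>T\<close> within distance \<open>r\<close> form the
  set swept out by \<open>T\<close> when it is translated along \<open>- r u\<close>. It consists of \<open>T\<close> and, up to null
  sets, disjoint parallelograms over those edges of \<open>T\<close> that face the incoming ray. With the boundary of \<open>T\<close> oriented
  counterclockwise, the parallelogram over an edge with direction vector \<open>d\<close> has area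
  \<open>r max 0 (d \<times> u)\<close>. As \<open>u\<close> turns once around the circle, \<open>max 0 (d \<times> u)\<close>
  integrates to \<open>2 |d|\<close> (Cauchy's perimeter formula). Hence by Fubini the distribution function
  is \<open>(\<pi> |T| + r L(T)) / (\<pi> |\<Omega>|)\<close> for \<open>0 \<le> r \<le> r\<^sub>m\<^sub>a\<^sub>x\<close>, and it is constant outside that range: it depends on
  \<open>T\<close> only through \<open>|T|\<close> and \<open>L(T)\<close>, and its values at \<open>0\<close> and \<open>r\<^sub>m\<^sub>a\<^sub>x\<close> determine both.
\<close>

section \<open>Cross product and the area of a parallelogram\<close>

text \<open>The determinant of the matrix with columns \<open>v\<close> and \<open>w\<close>;
  positive when \<open>w\<close> points to the left of \<open>v\<close>.\<close>

definition cross2 :: "real \<times> real \<Rightarrow> real \<times> real \<Rightarrow> real" where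
  "cross2 v w = fst v * snd w - snd v * fst w"

definition edges :: "(real \<times> real) set \<Rightarrow> (real \<times> real) set set" where
  "edges T = {E. E face_of T \<and> aff_dim E = 1}"

lemma diameter_closed_segment:
  fixes a b :: "'a::real_normed_vector"
  shows "diameter (closed_segment a b) = dist a b"
proof (rule antisym)
  show "diameter (closed_segment a b) \<le> dist a b"
  proof (rule diameter_le)
    fix x y assume "x \<in> closed_segment a b" "y \<in> closed_segment a b"
    then obtain s t where s: "0 \<le> s" "s \<le> 1" "x = (1 - s) *\<^sub>R a + s *\<^sub>R b"
      and t: "0 \<le> t" "t \<le> 1" "y = (1 - t) *\<^sub>R a + t *\<^sub>R b"
      unfolding closed_segment_def by blast
    have "x - y = (t - s) *\<^sub>R (a - b)"
      unfolding s t by (simp add: algebra_simps)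
    then have "norm (x - y) = \<bar>t - s\<bar> * dist a b"
      by (simp add: dist_norm)
    also have "\<dots> \<le> 1 * dist a b"
      using s t by (intro mult_right_mono) auto
    finally show "norm (x - y) \<le> dist a b" by simp
  qed auto
  show "dist a b \<le> diameter (closed_segment a b)"
    by (rule diameter_bounded_bound) (auto intro: compact_imp_bounded)
qed

text \<open>Carries the determinant formula \<open>measure_linear_image\<close>, which speaks of
  \<open>real^2\<close>, over to pairs of reals.\<close>

lemma distr_vec2_to_prod: "distr lborel borel (\<lambda>x::real^2. (x $ 1, x $ 2)) = lborel"
proof (rule lborel_eqI[symmetric])
  fix l u :: "real \<times> real"
  assume le: "\<And>b. b \<in> Basis \<Longrightarrow> l \<bullet> b \<le> u \<bullet> b"
  have le': "fst l \<le> fst u" "snd l \<le> snd u"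
    using le[of "(1,0)"] le[of "(0,1)"] by (auto simp: Basis_prod_def inner_prod_def)
  have m: "(\<lambda>x::real^2. (x $ 1, x $ 2)) \<in> borel_measurable lborel"
    by (auto intro!: borel_measurable_continuous_onI continuous_intros)
  have v: "(\<lambda>x::real^2. (x $ 1, x $ 2)) -` box l u = box (vector [fst l, snd l]) (vector [fst u, snd u])"
    by (auto simp: box_def Basis_prod_def inner_prod_def Basis_vec_def inner_axis forall_2)
  have B: "(Basis :: (real^2) set) = {axis 1 1, axis 2 1}"
    by (auto simp: Basis_vec_def exhaust_2) (metis exhaust_2)+
  have B2: "(Basis :: (real\<times>real) set) = {(1,0),(0,1)}"
    by (auto simp: Basis_prod_def)
  have ne: "axis 1 1 \<noteq> (axis 2 1 :: real^2)"
    by (simp add: axis_eq_axis)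
  show "emeasure (distr lborel borel (\<lambda>x::real^2. (x $ 1, x $ 2))) (box l u) = ennreal (\<Prod>b\<in>Basis. (u - l) \<bullet> b)"
    using m le' ne
    by (simp add: emeasure_distr v emeasure_lborel_box_eq B B2 inner_axis)
       (auto simp: inner_prod_def)
qed auto

text \<open>Up to translation and the passage to \<open>real^2\<close>, the parallelogram is the
  image of the unit square under the linear map \<open>h\<close>, whose determinant is
  \<open>cross2 v w\<close>.\<close>

lemma measure_parallelogram:
  fixes a v w :: "real \<times> real"
  shows "measure lebesgue ((\<lambda>(s, t). a + s *\<^sub>R v + t *\<^sub>R w) ` ({0..1} \<times> {0..1})) = \<bar>cross2 v w\<bar>"
proof -
  define g :: "real \<times> real \<Rightarrow> real \<times> real" where "g = (\<lambda>(s, t). s *\<^sub>R v + t *\<^sub>R w)"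
  define P where "P = g ` ({0..1} \<times> {0..1})"
  define h :: "real^2 \<Rightarrow> real^2"
    where "h = (\<lambda>x. vector [x $ 1 * fst v + x $ 2 * fst w, x $ 1 * snd v + x $ 2 * snd w])"
  have cP: "compact P"
    unfolding P_def g_def
    by (intro compact_continuous_image compact_Times continuous_intros) (auto simp: case_prod_beta intro!: continuous_intros)
  have m: "(\<lambda>x::real^2. (x $ 1, x $ 2)) \<in> borel_measurable lborel"
    by (auto intro!: borel_measurable_continuous_onI continuous_intros)
  have h: "linear h"
    by (rule linearI) (auto simp: h_def vec_eq_iff forall_2 algebra_simps)
  have det: "det (matrix h) = cross2 v w"
    by (simp add: det_2 matrix_def h_def cross2_def axis_def)
  have pre: "(\<lambda>x::real^2. (x $ 1, x $ 2)) -` P = h ` cbox 0 1"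
  proof (intro set_eqI iffI)
    fix x assume "x \<in> h ` cbox 0 1"
    then obtain y where y: "y \<in> cbox 0 1" "x = h y" by auto
    have "(x $ 1, x $ 2) = g (y $ 1, y $ 2)"
      unfolding y h_def g_def by (auto intro: prod_eqI)
    moreover have "(y $ 1, y $ 2) \<in> {0..1} \<times> {0..1}"
      using y by (auto simp: mem_box_cart)
    ultimately show "x \<in> (\<lambda>x::real^2. (x $ 1, x $ 2)) -` P"
      unfolding P_def vimage_eq by (rule image_eqI)
  next
    fix x :: "real^2" assume "x \<in> (\<lambda>x::real^2. (x $ 1, x $ 2)) -` P"
    then obtain s t where st: "s \<in> {0..1}" "t \<in> {0..1}" "(x $ 1, x $ 2) = g (s, t)"
      unfolding P_def by auto
    have "x = h (vector [s, t])"
      using st(3) by (auto simp: h_def g_def vec_eq_iff forall_2 prod_eq_iff)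
    moreover have "vector [s, t] \<in> cbox 0 (1 :: real^2)"
      using st by (auto simp: mem_box_cart forall_2)
    ultimately show "x \<in> h ` cbox 0 1" by blast
  qed
  have "measure lebesgue ((\<lambda>(s, t). a + s *\<^sub>R v + t *\<^sub>R w) ` ({0..1} \<times> {0..1})) = measure lebesgue ((+) a ` P)"
    unfolding P_def g_def image_image by (simp add: case_prod_beta add.assoc)
  also have "\<dots> = measure lebesgue P"
    by (rule measure_translation)
  also have "\<dots> = measure lborel P"
    using cP by (simp add: borel_compact)
  also have "\<dots> = measure lborel ((\<lambda>x::real^2. (x $ 1, x $ 2)) -` P)"
    by (subst distr_vec2_to_prod[symmetric], subst measure_distr)
       (use m cP in \<open>auto simp: borel_compact\<close>)
  also have "\<dots> = measure lebesgue (h ` cbox 0 1)"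
    unfolding pre using h
    by (subst measure_completion)
       (auto intro!: borel_compact compact_continuous_image linear_continuous_on simp: linear_conv_bounded_linear)
  also have "\<dots> = \<bar>cross2 v w\<bar> * measure lebesgue (cbox 0 (1::real^2))"
    using measure_linear_image[OF h] det by simp
  also have "measure lebesgue (cbox 0 (1::real^2)) = 1"
    by (simp add: content_cbox_cart interval_ne_empty_cart)
  finally show ?thesis by simp
qed

section \<open>The angular integral in Cauchy's perimeter formula\<close>

text \<open>Periodicity absorbs the shift: the pieces over \<open>{c..2 * pi}\<close> and
  \<open>{0..c}\<close> are translates of the pieces of \<open>g\<close> over
  \<open>{0..2 * pi - c}\<close> and \<open>{2 * pi - c..2 * pi}\<close>, which together make up one
  full period.\<close>

lemma has_integral_pos_part_sin_shift:
  assumes c: "0 \<le> c" "c \<le> 2 * pi"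
  shows "((\<lambda>x. max 0 (sin (x - c))) has_integral 2) {0..2 * pi}"
proof -
  define g :: "real \<Rightarrow> real" where "g = (\<lambda>x. max 0 (sin x))"
  have int: "g integrable_on {a..b}" for a b
    unfolding g_def by (intro integrable_continuous_real continuous_intros)
  have "(sin has_integral (- cos pi - (- cos 0))) {0..pi}"
    by (rule fundamental_theorem_of_calculus)
       (auto intro!: derivative_eq_intros simp flip: has_real_derivative_iff_has_vector_derivative)
  then have 1: "(g has_integral 2) {0..pi}"
    by (rule has_integral_eq_rhs[OF has_integral_eq, rotated]) (auto simp: g_def sin_ge_zero max_def intro: antisym)
  have "((\<lambda>x. 0) has_integral 0) {pi..2 * pi}"
    by simp
  then have 2: "(g has_integral 0) {pi..2 * pi}"
    proof (rule has_integral_eq[rotated])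
    fix x assume "x \<in> {pi..2 * pi}"
    then have "sin x \<le> 0"
      using sin_le_zero[of x] by (cases "x = 2 * pi") auto
    then show "0 = g x" by (simp add: g_def)
  qed
  have g: "(g has_integral 2) {0..2 * pi}"
    using has_integral_combine[OF _ _ 1 2] by simp
  have "((\<lambda>x. g (x - c)) has_integral integral {0..2 * pi - c} g) {c..2 * pi}"
    using has_integral_shift_real_ivl[OF integrable_integral[OF int[of 0 "2 * pi - c"]], of "- c"] by simp
  moreover have "((\<lambda>x. g (x - c)) has_integral integral {2 * pi - c..2 * pi} g) {0..c}"
  proof -
    have "g (x + (2 * pi - c)) = g (x - c)" for x
      using sin_periodic[of "x - c"] by (simp add: g_def algebra_simps)
    then show ?thesis
      using has_integral_shift_real_ivl[OF integrable_integral[OF int[of "2 * pi - c" "2 * pi"]], of "2 * pi - c"]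
      by simp
  qed
  moreover have "integral {0..2 * pi - c} g + integral {2 * pi - c..2 * pi} g = 2"
    using Henstock_Kurzweil_Integration.integral_combine[OF _ _ int, of 0 "2 * pi - c" "2 * pi"] g c
    by (simp add: integral_unique)
  ultimately have "((\<lambda>x. g (x - c)) has_integral 2) {0..2 * pi}"
    using has_integral_combine[of 0 c "2 * pi" "\<lambda>x. g (x - c)"] c by (metis add.commute)
  then show ?thesis by (simp add: g_def)
qed

text \<open>With \<open>c\<close> the polar angle of \<open>v\<close>, the cross product with the
  unit vector at angle \<theta> is \<open>norm v * sin (\<theta> - c)\<close>, so the previous
  integral applies.\<close>

lemma has_integral_pos_part_cross2:
  "((\<lambda>\<theta>. max 0 (cross2 v (cos \<theta>, sin \<theta>))) has_integral 2 * norm v) {0..2 * pi}"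
proof (cases "v = 0")
  case True
  then show ?thesis by (simp add: cross2_def)
next
  case False
  then have n: "norm v > 0" by simp
  have "(fst v / norm v)\<^sup>2 + (snd v / norm v)\<^sup>2 = 1"
    using False by (auto simp: norm_prod_def power_divide prod_eq_iff sum_power2_eq_zero_iff simp flip: add_divide_distrib)
  then obtain c where c: "fst v / norm v = cos c" "snd v / norm v = sin c" "0 \<le> c" "c \<le> 2 * pi"
    using sincos_total_2pi by (metis less_imp_le)
  have "cross2 v (cos \<theta>, sin \<theta>) = norm v * sin (\<theta> - c)" for \<theta>
  proof -
    have "fst v = norm v * cos c" "snd v = norm v * sin c"
      using n c(1,2) by (auto simp: field_simps)
    then show ?thesis by (simp add: cross2_def sin_diff algebra_simps)
  qed
  then have "max 0 (cross2 v (cos \<theta>, sin \<theta>)) = norm v * max 0 (sin (\<theta> - c))" for \<theta>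
    using n by (auto simp: max_def zero_le_mult_iff)
  then show ?thesis
    using has_integral_mult_right[OF has_integral_pos_part_sin_shift[OF c(3,4)], of "norm v"]
    by (simp add: mult.commute)
qed

section \<open>A convex polygon as the intersection of the half-planes to the left of its
  edges\<close>

lemma cross2_simps:
  "cross2 v (x + y) = cross2 v x + cross2 v y"
  "cross2 v (x - y) = cross2 v x - cross2 v y"
  "cross2 v (t *\<^sub>R x) = t * cross2 v x"
  by (simp_all add: cross2_def algebra_simps)

lemma cross2_self [simp]: "cross2 v v = 0"
  by (simp add: cross2_def)

text \<open>In the plane, two linear functionals vanishing on the same vector \<open>d\<close> are proportional.\<close>
lemma cross2_inner_swap:
  fixes a d x z :: "real \<times> real"
  assumes "a \<bullet> d = 0"
  shows "cross2 d x * (a \<bullet> z) = cross2 d z * (a \<bullet> x)"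
proof -
  have d: "fst a * fst d = - (snd a * snd d)"
    using assms by (simp add: inner_prod_def)
  have "cross2 d x * (a \<bullet> z) - cross2 d z * (a \<bullet> x)
      = (fst a * fst d + snd a * snd d) * (snd x * fst z - fst x * snd z)"
    by (simp add: cross2_def inner_prod_def algebra_simps)
  then show ?thesis using d by simp
qed

text \<open>Names the endpoints so that each directed edge runs counterclockwise, with
  \<open>T\<close> on its left. In a minimal half-plane description the facets, here the edges, are
  exactly the sets where one constraint is tight; an interior point \<open>z\<close> decides the
  orientation.\<close>

lemma convex_polygon_edges:
  assumes T: "convex_polygon T"
  obtains A B where
    "\<And>E. E \<in> edges T \<Longrightarrow> E = closed_segment (A E) (B E)"
    "\<And>E. E \<in> edges T \<Longrightarrow> E = {x \<in> T. cross2 (B E - A E) (x - A E) = 0}"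
    "T = {x. \<forall>E\<in>edges T. 0 \<le> cross2 (B E - A E) (x - A E)}"
proof -
  obtain z where z: "z \<in> interior T"
    using T unfolding convex_polygon_def by blast
  have pT: "polytope T" and int: "interior T \<noteq> {}"
    using T unfolding convex_polygon_def by auto
  have aff: "affine hull T = UNIV"
    using int by (rule affine_hull_nonempty_interior)
  have dim: "aff_dim T = 2"
    using aff_dim_nonempty_interior[OF int] by simp
  obtain F where "finite F" and seq: "T = affine hull T \<inter> \<Inter>F"
    and ex: "\<forall>h\<in>F. \<exists>a b. a \<noteq> 0 \<and> h = {x. a \<bullet> x \<le> b}"
    and min: "\<And>F'. F' \<subset> F \<Longrightarrow> T \<subset> affine hull T \<inter> \<Inter>F'"
    using polytope_imp_polyhedron[OF pT] unfolding polyhedron_Int_affine_minimal by blast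
  from ex obtain a b where ab: "\<And>h. h \<in> F \<Longrightarrow> a h \<noteq> 0 \<and> h = {x. a h \<bullet> x \<le> b h}"
    by metis
  have TF: "T = {x. \<forall>h\<in>F. a h \<bullet> x \<le> b h}"
    using seq ab unfolding aff by auto
  have edge: "E \<in> edges T \<longleftrightarrow> (\<exists>h. h \<in> F \<and> E = T \<inter> {x. a h \<bullet> x = b h})" for E
  proof -
    have "E \<in> edges T \<longleftrightarrow> E facet_of T"
      by (auto simp: edges_def facet_of_def dim)
    also have "\<dots> \<longleftrightarrow> (\<exists>h. h \<in> F \<and> E = T \<inter> {x. a h \<bullet> x = b h})"
      by (rule facet_of_polyhedron_explicit[OF \<open>finite F\<close> seq ab min])
    finally show ?thesis .
  qed
  have zlt: "a h \<bullet> z < b h" if "h \<in> F" for h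
  proof -
    have "interior T \<subseteq> interior {x. a h \<bullet> x \<le> b h}"
      using that by (intro interior_mono) (auto simp: TF)
    then have "z \<in> {x. a h \<bullet> x < b h}"
      using z ab[OF that] interior_halfspace_le[of "a h" "b h"] by blast
    then show ?thesis by simp
  qed
  have *: "\<exists>p q. E = closed_segment p q \<and> 0 < cross2 (q - p) (z - p)" if E: "E \<in> edges T" for E
  proof -
    obtain h where h: "h \<in> F" "E = T \<inter> {x. a h \<bullet> x = b h}"
      using E edge by blast
    have "E face_of T" "aff_dim E = 1"
      using E by (auto simp: edges_def)
    then have "compact E" "convex E" "collinear E" "E \<noteq> {}"
      using pT face_of_polytope_polytope[OF pT] polytope_imp_compact polytope_imp_convex
      by (auto simp: collinear_aff_dim)
    then obtain p q where pq: "E = closed_segment p q"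
      using compact_convex_collinear_segment by metis
    have "p \<noteq> q"
      using pq \<open>aff_dim E = 1\<close> by auto
    have on: "a h \<bullet> p = b h" "a h \<bullet> q = b h"
      using h pq by (auto dest: equalityD2)
    \<comment> \<open>If this vanished, \<open>cross2_inner_swap\<close> would make
      \<open>cross2 (q - p)\<close> vanish on every vector, because \<open>z\<close> lies strictly
      inside the half-plane; that forces \<open>p = q\<close>.\<close>
    have "cross2 (q - p) (z - p) \<noteq> 0"
    proof
      assume 0: "cross2 (q - p) (z - p) = 0"
      have "cross2 (q - p) x = 0" for x
        using cross2_inner_swap[of "a h" "q - p" x "z - p"] on zlt[OF h(1)] 0
        by (auto simp: inner_diff_right)
      from this[of "(1,0)"] this[of "(0,1)"] show False
        using \<open>p \<noteq> q\<close> by (simp add: cross2_def prod_eq_iff)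
    qed
    \<comment> \<open>Exchanging the endpoints flips the sign, so one of the two orders is
      counterclockwise.\<close>
    moreover have "cross2 (p - q) (z - q) = - cross2 (q - p) (z - p)"
      by (simp add: cross2_def algebra_simps)
    ultimately show ?thesis
      using pq closed_segment_commute[of p q] by (metis linorder_neqE_linordered_idom neg_0_less_iff_less)
  qed
  then obtain A B where AB: "\<And>E. E \<in> edges T \<Longrightarrow> E = closed_segment (A E) (B E)"
    and pos: "\<And>E. E \<in> edges T \<Longrightarrow> 0 < cross2 (B E - A E) (z - A E)"
    by metis
  \<comment> \<open>Both \<open>cross2 (B E - A E) (x - A E)\<close> and
    \<open>b h - a h \<bullet> x\<close> are affine in \<open>x\<close> and vanish along the edge,
    hence are proportional; both are positive at \<open>z\<close>, so their signs agree
    everywhere.\<close>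
  have sgn: "0 \<le> cross2 (B E - A E) (x - A E) \<longleftrightarrow> a h \<bullet> x \<le> b h"
    "0 = cross2 (B E - A E) (x - A E) \<longleftrightarrow> a h \<bullet> x = b h"
    if h: "h \<in> F" "E = T \<inter> {x. a h \<bullet> x = b h}" for E h x
  proof -
    have E: "E \<in> edges T" using h edge by blast
    have on: "a h \<bullet> A E = b h" "a h \<bullet> B E = b h"
      using h(2) AB[OF E] by (metis (mono_tags) IntE ends_in_segment mem_Collect_eq)+
    define k where "k = cross2 (B E - A E) (z - A E)"
    have "cross2 (B E - A E) (x - A E) * (b h - a h \<bullet> z) = k * (b h - a h \<bullet> x)"
      using cross2_inner_swap[of "a h" "B E - A E" "x - A E" "z - A E"] on
      by (simp add: inner_diff_right k_def algebra_simps)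
    moreover have "k > 0" using pos[OF E] by (simp add: k_def)
    moreover have "b h - a h \<bullet> z > 0" using zlt[OF h(1)] by simp
    ultimately have "cross2 (B E - A E) (x - A E) = k * (b h - a h \<bullet> x) / (b h - a h \<bullet> z)"
      by (simp add: field_simps)
    then show "0 \<le> cross2 (B E - A E) (x - A E) \<longleftrightarrow> a h \<bullet> x \<le> b h"
      "0 = cross2 (B E - A E) (x - A E) \<longleftrightarrow> a h \<bullet> x = b h"
      using \<open>k > 0\<close> \<open>b h - a h \<bullet> z > 0\<close>
      by (auto simp: zero_le_divide_iff zero_le_mult_iff)
  qed
  show ?thesis
  proof (rule that[OF AB])
    fix E assume E: "E \<in> edges T"
    then obtain h where h: "h \<in> F" "E = T \<inter> {x. a h \<bullet> x = b h}"
      using edge by blast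
    show "E = {x \<in> T. cross2 (B E - A E) (x - A E) = 0}"
      using sgn(2)[OF h] h(2) by auto
  next
    have "(\<forall>h\<in>F. a h \<bullet> x \<le> b h) \<longleftrightarrow> (\<forall>E\<in>edges T. 0 \<le> cross2 (B E - A E) (x - A E))" for x
      using sgn(1) edge by metis
    then have "{x. \<forall>h\<in>F. a h \<bullet> x \<le> b h} = {x. \<forall>E\<in>edges T. 0 \<le> cross2 (B E - A E) (x - A E)}"
      by simp
    with TF show "T = {x. \<forall>E\<in>edges T. 0 \<le> cross2 (B E - A E) (x - A E)}"
      by (rule trans)
  qed auto
qed

lemma finite_edges: "polytope T \<Longrightarrow> finite (edges T)"
  unfolding edges_def by (rule finite_subset[OF _ finite_polytope_faces]) auto

text \<open>The intersection is a face of both edges; as they differ, it is a proper face of at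
  least one of them, so its dimension is below 1.\<close>

lemma edges_Int_subset_singleton:
  assumes "E \<in> edges T" "E' \<in> edges T" "E \<noteq> E'"
  shows "\<exists>x. E \<inter> E' \<subseteq> {x}"
proof -
  have f: "E face_of T" "E' face_of T" and d: "aff_dim E = 1" "aff_dim E' = 1"
    using assms by (auto simp: edges_def)
  have fE: "E \<inter> E' face_of E" "E \<inter> E' face_of E'"
    using face_of_Int[OF f] face_of_subset f face_of_imp_subset by blast+
  have cv: "convex E" "convex E'"
    using f face_of_imp_convex by auto
  have "aff_dim (E \<inter> E') < 1"
    using face_of_aff_dim_lt[OF cv(1) fE(1)] face_of_aff_dim_lt[OF cv(2) fE(2)] d assms(3) by auto
  then have "aff_dim (E \<inter> E') = 0 \<or> aff_dim (E \<inter> E') = -1"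
    using aff_dim_geq[of "E \<inter> E'"] by linarith
  then show ?thesis
    by (metis aff_dim_eq_0 aff_dim_empty empty_subsetI order_refl)
qed

lemma negligible_closed_segment:
  fixes a b :: "'a::euclidean_space"
  assumes "2 \<le> DIM('a)"
  shows "negligible (closed_segment a b)"
  using interior_closed_segment_ge2[OF assms, of a b] negligible_convex_interior[of "closed_segment a b"]
  by simp

section \<open>Swept sets and their areas\<close>

text \<open>For \<open>0 \<le> r\<close> this is the Minkowski sum of \<open>S\<close> and the
  segment from \<open>0\<close> to \<open>- r *\<^sub>R u\<close>.\<close>

definition sweep :: "real \<Rightarrow> 'a::real_vector \<Rightarrow> 'a set \<Rightarrow> 'a set" where
  "sweep r u S = {p. \<exists>t\<in>{0..r}. p + t *\<^sub>R u \<in> S}"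

lemma sweep_eq_image: "sweep r u S = (\<lambda>(x, t). x - t *\<^sub>R u) ` (S \<times> {0..r})"
proof (intro set_eqI iffI)
  fix p assume "p \<in> sweep r u S"
  then obtain t where "t \<in> {0..r}" "p + t *\<^sub>R u \<in> S" by (auto simp: sweep_def)
  then show "p \<in> (\<lambda>(x, t). x - t *\<^sub>R u) ` (S \<times> {0..r})"
    by (intro image_eqI[of _ _ "(p + t *\<^sub>R u, t)"]) auto
next
  fix p assume "p \<in> (\<lambda>(x, t). x - t *\<^sub>R u) ` (S \<times> {0..r})"
  then obtain x t where "x \<in> S" "t \<in> {0..r}" "p = x - t *\<^sub>R u" by auto
  then show "p \<in> sweep r u S"
    by (auto simp: sweep_def intro!: bexI[of _ t])
qed

lemma compact_sweep:
  fixes S :: "'a::real_normed_vector set"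
  shows "compact S \<Longrightarrow> compact (sweep r u S)"
  unfolding sweep_eq_image
  by (intro compact_continuous_image compact_Times) (auto simp: case_prod_beta intro!: continuous_intros)

lemma measure_sweep_closed_segment:
  fixes a b u :: "real \<times> real"
  assumes "0 \<le> r"
  shows "measure lebesgue (sweep r u (closed_segment a b)) = r * \<bar>cross2 (b - a) u\<bar>"
proof -
  have "sweep r u (closed_segment a b)
      = (\<lambda>(s, t). a + s *\<^sub>R (b - a) + t *\<^sub>R (- r *\<^sub>R u)) ` ({0..1} \<times> {0..1})" (is "_ = ?P")
  proof (intro set_eqI iffI)
    fix p assume "p \<in> sweep r u (closed_segment a b)"
    then obtain s t where st: "s \<in> {0..1}" "t \<in> {0..r}" "p = a + s *\<^sub>R (b - a) - t *\<^sub>R u"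
      unfolding sweep_eq_image by (auto simp: closed_segment_def algebra_simps)
    show "p \<in> ?P"
    proof (rule image_eqI)
      \<comment> \<open>The second coordinate is the time in units of \<open>r\<close>. For
        \<open>r = 0\<close> also \<open>t = 0\<close>, and division by zero yields the right value
        \<open>0\<close>.\<close>
      show "(s, t / r) \<in> {0..1} \<times> {0..1}"
        using st by (auto simp: divide_le_eq_1)
      show "p = (case (s, t / r) of (s, t) \<Rightarrow> a + s *\<^sub>R (b - a) + t *\<^sub>R (- r *\<^sub>R u))"
        using st by (cases "r = 0") auto
    qed
  next
    fix p assume "p \<in> ?P"
    then obtain s t where st: "s \<in> {0..1}" "t \<in> {0..1}" "p = a + s *\<^sub>R (b - a) - (t * r) *\<^sub>R u"
      by auto
    have "t * r \<in> {0..r}"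
      using st assms mult_right_mono[of t 1 r] by auto
    moreover have "a + s *\<^sub>R (b - a) \<in> closed_segment a b"
      using st by (auto simp: closed_segment_def algebra_simps intro!: exI[of _ s])
    ultimately show "p \<in> sweep r u (closed_segment a b)"
      unfolding sweep_def st(3) by (auto intro!: bexI[of _ "t * r"])
  qed
  moreover have "\<bar>cross2 (b - a) (- r *\<^sub>R u)\<bar> = r * \<bar>cross2 (b - a) u\<bar>"
    using assms by (simp only: cross2_simps) (simp add: abs_mult)
  ultimately show ?thesis
    using measure_parallelogram by metis
qed

text \<open>Along the ray from a point outside \<open>T\<close> every constraint is an affine
  function of time. Those violated at the start hold at time \<open>t0\<close>, so they increase;
  when the last of them reaches zero all constraints hold, and the ray meets \<open>T\<close> where
  that constraint is tight.\<close>

lemma sweep_subset_facing_edges: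
  assumes fin: "finite I"
    and T: "T = {x. \<forall>E\<in>I. 0 \<le> cross2 (d E) (x - A E)}"
  shows "sweep r u T \<subseteq> T \<union> (\<Union>E\<in>{E\<in>I. 0 < cross2 (d E) u}. sweep r u {x \<in> T. cross2 (d E) (x - A E) = 0})"
proof
  fix p assume "p \<in> sweep r u T"
  then obtain t0 where t0: "0 \<le> t0" "t0 \<le> r" "p + t0 *\<^sub>R u \<in> T"
    by (auto simp: sweep_def)
  define f where "f E t = cross2 (d E) (p - A E) + t * cross2 (d E) u" for E t
  have f: "cross2 (d E) (p + t *\<^sub>R u - A E) = f E t" for E t
    by (simp add: f_def cross2_def algebra_simps)
  have f0: "cross2 (d E) (p - A E) = f E 0" for E
    by (simp add: f_def)
  show "p \<in> T \<union> (\<Union>E\<in>{E\<in>I. 0 < cross2 (d E) u}. sweep r u {x \<in> T. cross2 (d E) (x - A E) = 0})"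
  proof (cases "p \<in> T")
    case False
    define V where "V = {E \<in> I. f E 0 < 0}"
    define \<tau> where "\<tau> E = - f E 0 / cross2 (d E) u" for E
    have "finite V" "V \<noteq> {}"
      using fin False f0 by (auto simp: V_def T not_le)
    have V: "0 < cross2 (d E) u" "0 < \<tau> E" "\<tau> E \<le> t0" "f E (\<tau> E) = 0" if "E \<in> V" for E
    proof -
      have neg: "f E 0 < 0" and nn: "0 \<le> f E t0"
        using that t0(3) f unfolding V_def T by auto
      then have "0 < t0 * cross2 (d E) u" by (auto simp: f_def)
      then show c: "0 < cross2 (d E) u" using t0(1) by (auto simp: zero_less_mult_iff)
      show "0 < \<tau> E" "\<tau> E \<le> t0" "f E (\<tau> E) = 0"
        using c neg nn by (auto simp: \<tau>_def f_def field_simps)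
    qed
    have "Max (\<tau> ` V) \<in> \<tau> ` V"
      using \<open>finite V\<close> \<open>V \<noteq> {}\<close> by (intro Max_in) auto
    then obtain E where E: "E \<in> V" "\<tau> E = Max (\<tau> ` V)" by force
    have mx: "\<tau> E' \<le> \<tau> E" if "E' \<in> V" for E'
      using that E(2) \<open>finite V\<close> by simp
    have "0 \<le> f E' (\<tau> E)" if E': "E' \<in> I" for E'
    proof (cases "E' \<in> V")
      case True
      have "f E' (\<tau> E') \<le> f E' (\<tau> E)"
        using mx[OF True] V(1)[OF True] by (auto simp: f_def intro!: mult_right_mono)
      then show ?thesis using V(4)[OF True] by simp
    next
      case False
      then have 0: "0 \<le> f E' 0" using E' by (auto simp: V_def)
      have 1: "0 \<le> f E' t0" using t0(3) E' f unfolding T by auto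
      have r: "0 < \<tau> E" "\<tau> E \<le> t0" using V(2,3)[OF E(1)] .
      \<comment> \<open>A constraint that holds at times \<open>0\<close> and \<open>t0\<close>
        holds in between: its value at \<open>\<tau> E\<close> is a convex combination of the two,
        here multiplied by \<open>t0\<close>.\<close>
      have "t0 * f E' (\<tau> E) = (t0 - \<tau> E) * f E' 0 + \<tau> E * f E' t0"
        by (simp add: f_def algebra_simps)
      also have "\<dots> \<ge> 0" using 0 1 r by simp
      finally show ?thesis using r by (simp add: zero_le_mult_iff)
    qed
    then have "p + \<tau> E *\<^sub>R u \<in> {x \<in> T. cross2 (d E) (x - A E) = 0}"
      using V(4)[OF E(1)] f unfolding T by auto
    moreover have "\<tau> E \<in> {0..r}"
      using V(2,3)[OF E(1)] t0 by auto
    ultimately have "p \<in> sweep r u {x \<in> T. cross2 (d E) (x - A E) = 0}"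
      unfolding sweep_def by blast
    then show ?thesis using E(1) V(1)[OF E(1)] by (auto simp: V_def)
  qed auto
qed

text \<open>\<open>T\<close> and the sweeps of the facing edges \<open>N\<close> make up the swept
  set and overlap only in null sets, so their areas add; for edges outside \<open>N\<close> the
  \<open>max\<close> is \<open>0\<close>.\<close>

lemma area_sweep:
  assumes P: "convex_polygon T" and r: "0 \<le> r"
    and seg: "\<And>E. E \<in> edges T \<Longrightarrow> E = closed_segment (A E) (B E)"
    and E_eq: "\<And>E. E \<in> edges T \<Longrightarrow> E = {x \<in> T. cross2 (B E - A E) (x - A E) = 0}"
    and T_eq: "T = {x. \<forall>E\<in>edges T. 0 \<le> cross2 (B E - A E) (x - A E)}"
  shows "measure lebesgue (sweep r u T) = area T + r * (\<Sum>E\<in>edges T. max 0 (cross2 (B E - A E) u))"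
proof -
  define N where "N = {E \<in> edges T. 0 < cross2 (B E - A E) u}"
  have pT: "polytope T" using P by (simp add: convex_polygon_def)
  then have fin: "finite (edges T)" by (rule finite_edges)
  then have finN: "finite N" by (simp add: N_def)
  have cT: "compact T" using pT by (rule polytope_imp_compact)
  have Nseg: "E = closed_segment (A E) (B E)" "E \<in> edges T" "E \<subseteq> T" if "E \<in> N" for E
  proof -
    show E: "E \<in> edges T" using that by (simp add: N_def)
    show "E = closed_segment (A E) (B E)" using E by (rule seg)
    show "E \<subseteq> T" using E by (simp add: edges_def face_of_imp_subset)
  qed
  have cE: "compact E" if "E \<in> N" for E
    using Nseg(1)[OF that] compact_segment by metis
  have mE: "sweep r u E \<in> lmeasurable" if "E \<in> N" for E
    using cE[OF that] by (intro lmeasurable_compact compact_sweep)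
  have sub1: "sweep r u T \<subseteq> T \<union> (\<Union>E\<in>N. sweep r u E)"
  proof -
    have "(\<Union>E\<in>N. sweep r u {x \<in> T. cross2 (B E - A E) (x - A E) = 0}) = (\<Union>E\<in>N. sweep r u E)"
      using E_eq Nseg(2) by (metis (no_types, lifting) SUP_cong)
    then show ?thesis
      using sweep_subset_facing_edges[OF fin T_eq, of r u] by (simp add: N_def)
  qed
  have eq: "sweep r u T = T \<union> (\<Union>E\<in>N. sweep r u E)"
  proof (rule antisym[OF sub1])
    have "T \<subseteq> sweep r u T" using r by (auto simp: sweep_def intro!: bexI[of _ 0])
    moreover have "sweep r u E \<subseteq> sweep r u T" if "E \<in> N" for E
      using Nseg(3)[OF that] by (auto simp: sweep_def)
    ultimately show "T \<union> (\<Union>E\<in>N. sweep r u E) \<subseteq> sweep r u T" by blast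
  qed
  \<comment> \<open>Walking backwards along \<open>u\<close> from a facing edge leaves \<open>T\<close> and never returns.\<close>
  have leave: "t = 0" if "E \<in> N" "x \<in> E" "0 \<le> t" "x - t *\<^sub>R u \<in> T" for E x t
  proof -
    have "0 \<le> cross2 (B E - A E) (x - t *\<^sub>R u - A E)"
      using that(4) Nseg(2)[OF that(1)] T_eq by blast
    moreover have "cross2 (B E - A E) (x - A E) = 0"
      using E_eq[OF Nseg(2)[OF that(1)]] that(2) by blast
    ultimately have "t * cross2 (B E - A E) u \<le> 0"
      by (simp add: cross2_simps)
    moreover have "0 < cross2 (B E - A E) u" using that(1) by (simp add: N_def)
    ultimately show ?thesis using that(3) by (simp add: mult_le_0_iff)
  qed
  \<comment> \<open>By \<open>leave\<close>, a point of \<open>T\<close> in the sweep of a facing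
    edge has travel time \<open>0\<close>, so it lies on that edge.\<close>
  have negT: "negligible (T \<inter> (\<Union>E\<in>N. sweep r u E))"
  proof (rule negligible_subset)
    show "negligible (\<Union>N)"
    proof (rule negligible_Union[OF finN])
      fix E assume E: "E \<in> N"
      have "negligible (closed_segment (A E) (B E))"
        by (simp add: negligible_closed_segment)
      then show "negligible E"
        by (simp flip: Nseg(1)[OF E])
    qed
    show "T \<inter> (\<Union>E\<in>N. sweep r u E) \<subseteq> \<Union>N"
    proof
      fix p assume "p \<in> T \<inter> (\<Union>E\<in>N. sweep r u E)"
      then obtain E t where "p \<in> T" "E \<in> N" "0 \<le> t" "p + t *\<^sub>R u \<in> E"
        by (auto simp: sweep_def)
      then show "p \<in> \<Union>N" using leave[of E "p + t *\<^sub>R u" t] by auto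
    qed
  qed
  \<comment> \<open>By \<open>leave\<close>, a point of both sweeps reaches the two edges at the
    same time, hence at their only possible common point \<open>x\<close>; such points fill at most
    one segment ending at \<open>x\<close>.\<close>
  have negE: "negligible (sweep r u E \<inter> sweep r u E')" if N: "E \<in> N" "E' \<in> N" "E \<noteq> E'" for E E'
  proof -
    obtain x where x: "E \<inter> E' \<subseteq> {x}"
      using edges_Int_subset_singleton[OF Nseg(2)[OF N(1)] Nseg(2)[OF N(2)] N(3)] by blast
    have "sweep r u E \<inter> sweep r u E' \<subseteq> closed_segment x (x - r *\<^sub>R u)"
    proof
      fix p assume "p \<in> sweep r u E \<inter> sweep r u E'"
      then obtain t t' where t: "0 \<le> t" "t \<le> r" "p + t *\<^sub>R u \<in> E"
        and t': "0 \<le> t'" "t' \<le> r" "p + t' *\<^sub>R u \<in> E'"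
        by (auto simp: sweep_def)
      have "t' - t = 0" if "t \<le> t'"
        using leave[OF \<open>E' \<in> N\<close> t'(3), of "t' - t"] that t(3) Nseg(3)[OF \<open>E \<in> N\<close>]
        by (auto simp: algebra_simps)
      moreover have "t - t' = 0" if "t' \<le> t"
        using leave[OF \<open>E \<in> N\<close> t(3), of "t - t'"] that t'(3) Nseg(3)[OF \<open>E' \<in> N\<close>]
        by (auto simp: algebra_simps)
      ultimately have "t = t'" by linarith
      then have "x = p + t *\<^sub>R u" using t t' x by blast
      then have p: "p = x - t *\<^sub>R u" by simp
      show "p \<in> closed_segment x (x - r *\<^sub>R u)"
      proof (cases "r = 0")
        case False
        then show ?thesis using t r unfolding p closed_segment_def
          by (auto intro!: exI[of _ "t / r"] simp: algebra_simps divide_le_eq_1)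
      qed (use p t in auto)
    qed
    then show ?thesis by (rule negligible_subset[rotated]) (simp add: negligible_closed_segment)
  qed
  have "measure lebesgue (sweep r u T) = measure lebesgue T + measure lebesgue (\<Union>E\<in>N. sweep r u E)"
    unfolding eq using measure_Un3_negligible[of T "\<Union>E\<in>N. sweep r u E" "{}"] negT mE finN cT
    by (simp add: fmeasurable.finite_UN lmeasurable_compact)
  also have "measure lebesgue (\<Union>E\<in>N. sweep r u E) = (\<Sum>E\<in>N. measure lebesgue (sweep r u E))"
    using finN mE negE by (intro measure_negligible_finite_Union_image) (auto simp: pairwise_def)
  also have "\<dots> = (\<Sum>E\<in>N. r * max 0 (cross2 (B E - A E) u))"
  proof (rule sum.cong)
    fix E assume E: "E \<in> N"
    then have "0 < cross2 (B E - A E) u" by (simp add: N_def)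
    then show "measure lebesgue (sweep r u E) = r * max 0 (cross2 (B E - A E) u)"
      using measure_sweep_closed_segment[OF r, of u "A E" "B E"] by (simp flip: Nseg(1)[OF E])
  qed simp
  also have "\<dots> = (\<Sum>E\<in>edges T. r * max 0 (cross2 (B E - A E) u))"
    using fin by (intro sum.mono_neutral_left) (auto simp: N_def)
  finally show ?thesis by (simp add: area_def sum_distrib_left)
qed

text \<open>Cauchy's formula, edge by edge: the area term is constant in the angle, and each edge
  contributes \<open>r\<close> times twice its length.\<close>

lemma integral_area_sweep:
  assumes P: "convex_polygon T" and r: "0 \<le> r"
  shows "((\<lambda>\<theta>. measure lebesgue (sweep r (cos \<theta>, sin \<theta>) T))
    has_integral 2 * pi * area T + 2 * r * perimeter T) {0..2 * pi}"
proof -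
  obtain A B where AB:
    "\<And>E. E \<in> edges T \<Longrightarrow> E = closed_segment (A E) (B E)"
    "\<And>E. E \<in> edges T \<Longrightarrow> E = {x \<in> T. cross2 (B E - A E) (x - A E) = 0}"
    "T = {x. \<forall>E\<in>edges T. 0 \<le> cross2 (B E - A E) (x - A E)}"
    by (rule convex_polygon_edges[OF P]) (rule that; assumption)
  have fin: "finite (edges T)"
    using P finite_edges by (simp add: convex_polygon_def)
  have "perimeter T = (\<Sum>E\<in>edges T. norm (B E - A E))"
    unfolding perimeter_def edges_def[symmetric]
  proof (rule sum.cong)
    fix E assume "E \<in> edges T"
    then show "diameter E = norm (B E - A E)"
      using AB(1) diameter_closed_segment[of "A E" "B E"] by (metis dist_commute dist_norm)
  qed simp
  moreover have "((\<lambda>\<theta>. area T + r * (\<Sum>E\<in>edges T. max 0 (cross2 (B E - A E) (cos \<theta>, sin \<theta>))))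
      has_integral 2 * pi * area T + r * (\<Sum>E\<in>edges T. 2 * norm (B E - A E))) {0..2 * pi}"
    using has_integral_const_real[of "area T" 0 "2 * pi"]
    by (intro has_integral_add has_integral_mult_right has_integral_sum fin has_integral_pos_part_cross2)
       simp
  moreover have "measure lebesgue (sweep r (cos \<theta>, sin \<theta>) T)
      = area T + r * (\<Sum>E\<in>edges T. max 0 (cross2 (B E - A E) (cos \<theta>, sin \<theta>)))" for \<theta>
    by (rule area_sweep[OF P r AB])
  ultimately show ?thesis
    by (simp add: sum_distrib_left mult.assoc mult.left_commute)
qed

section \<open>The distribution function via Fubini\<close>

text \<open>Needed for Fubini with \<open>lebesgue\<close> as a factor. A countable cover for
  \<open>lborel\<close> also serves its completion, since the two measures agree on the sets of
  \<open>lborel\<close>.\<close>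

lemma sigma_finite_lebesgue: "sigma_finite_measure (lebesgue :: 'a::euclidean_space measure)"
proof
  obtain C :: "'a set set" where "countable C" "C \<subseteq> sets lborel" "\<Union>C = space lborel" "\<forall>a\<in>C. emeasure lborel a \<noteq> \<infinity>"
    using lborel.sigma_finite_countable by blast
  then show "\<exists>A. countable A \<and> A \<subseteq> sets (lebesgue :: 'a measure) \<and> \<Union>A = space lebesgue \<and>
      (\<forall>a\<in>A. emeasure lebesgue a \<noteq> \<infinity>)"
    by (intro exI[of _ C]) (auto simp: emeasure_completion subset_eq main_part_sets)
qed

text \<open>Since \<open>T\<close> is closed, the set of hit times is closed as well and, if
  nonempty, contains its infimum; a first hit by time \<open>r\<close> is then the same as some hit
  by time \<open>r\<close>.\<close>

lemma Inf_hit_times_le_iff: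
  assumes "compact T"
  shows "hit_times rmax T p \<theta> \<noteq> {} \<and> Inf (hit_times rmax T p \<theta>) \<le> r
    \<longleftrightarrow> p \<in> sweep (min r rmax) (cos \<theta>, sin \<theta>) T"
proof -
  define H where "H = hit_times rmax T p \<theta>"
  have H: "H = {0..rmax} \<inter> (\<lambda>t. p + t *\<^sub>R (cos \<theta>, sin \<theta>)) -` T"
    by (cases p) (auto simp: H_def hit_times_def)
  have "closed ((\<lambda>t. p + t *\<^sub>R (cos \<theta>, sin \<theta>)) -` T)"
    using assms by (intro continuous_closed_vimage compact_imp_closed) (auto intro!: continuous_intros)
  then have cl: "closed H" unfolding H by (intro closed_Int) auto
  have bdd: "bdd_below H" unfolding H by (auto intro!: bdd_belowI[of _ 0])
  have sw: "p \<in> sweep (min r rmax) (cos \<theta>, sin \<theta>) T \<longleftrightarrow> (\<exists>t\<in>H. t \<le> r)"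
    unfolding sweep_def H by force
  have "H \<noteq> {} \<and> Inf H \<le> r \<longleftrightarrow> (\<exists>t\<in>H. t \<le> r)"
    using closed_contains_Inf[OF _ bdd cl] cInf_lower[OF _ bdd] by (force intro: order_trans)
  then show ?thesis unfolding sw H_def .
qed

text \<open>With the angle confined to \<open>{- real n..real n}\<close> the graph is a continuous
  image of a compact set, so the whole graph is a countable union of compact sets.\<close>

lemma sweep_graph_borel:
  fixes T :: "(real \<times> real) set"
  assumes "compact T"
  shows "{(p, \<theta>). p \<in> sweep r (cos \<theta>, sin \<theta>) T} \<in> sets borel"
proof -
  define g :: "(real \<times> real) \<times> real \<times> real \<Rightarrow> (real \<times> real) \<times> real"
    where "g = (\<lambda>(x, t, \<theta>). (x - t *\<^sub>R (cos \<theta>, sin \<theta>), \<theta>))"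
  have "{(p, \<theta>). p \<in> sweep r (cos \<theta>, sin \<theta>) T} = (\<Union>n::nat. g ` (T \<times> {0..r} \<times> {- real n..real n}))"
  proof (intro set_eqI iffI)
    fix z assume "z \<in> {(p, \<theta>). p \<in> sweep r (cos \<theta>, sin \<theta>) T}"
    then obtain x t \<theta> where z: "z = g (x, t, \<theta>)" "x \<in> T" "t \<in> {0..r}"
      by (auto simp: sweep_eq_image g_def)
    obtain n where "\<bar>\<theta>\<bar> \<le> real n" using real_arch_simple by blast
    then have "(x, t, \<theta>) \<in> T \<times> {0..r} \<times> {- real n..real n}" using z by auto
    then show "z \<in> (\<Union>n::nat. g ` (T \<times> {0..r} \<times> {- real n..real n}))"
      using z(1) by blast
  next
    fix z assume "z \<in> (\<Union>n::nat. g ` (T \<times> {0..r} \<times> {- real n..real n}))"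
    then obtain x t \<theta> where "z = g (x, t, \<theta>)" "x \<in> T" "t \<in> {0..r}" by blast
    then show "z \<in> {(p, \<theta>). p \<in> sweep r (cos \<theta>, sin \<theta>) T}"
      by (auto simp: sweep_eq_image g_def intro!: image_eqI[of _ _ "(x, t)"])
  qed
  moreover have "g ` (T \<times> {0..r} \<times> {- real n..real n}) \<in> sets borel" for n
    using assms unfolding g_def
    by (intro borel_compact compact_continuous_image compact_Times)
       (auto simp: case_prod_beta intro!: continuous_intros)
  ultimately show ?thesis by auto
qed

text \<open>Secures the division by the area of \<Omega>: a convex set with nonempty interior is not
  null.\<close>

lemma admissible_target_imp_measure_pos:
  assumes \<Omega>: "\<Omega> \<in> lmeasurable" and T: "admissible_target \<Omega> rmax T"
  shows "0 < measure lebesgue \<Omega>"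
proof -
  have "polytope T" "interior T \<noteq> {}" and sub: "T \<subseteq> \<Omega>"
    using T by (auto simp: admissible_target_def convex_polygon_def)
  then have m: "T \<in> lmeasurable" and "\<not> negligible T"
    using negligible_convex_interior[of T]
    by (auto simp: polytope_imp_convex polytope_imp_compact lmeasurable_compact)
  then have "0 < measure lebesgue T"
    using negligible_iff_measure0[OF m] by (simp add: less_le)
  also have "\<dots> \<le> measure lebesgue \<Omega>"
    using m by (intro measure_mono_fmeasurable[OF sub _ \<Omega>]) auto
  finally show ?thesis .
qed

text \<open>Slicing the detection event by angle turns its mass into the integral of
  \<open>integral_area_sweep\<close> at radius \<open>min r rmax\<close>; normalization divides by
  \<open>2 * pi\<close> times the area of \<Omega>.\<close>

lemma dist_fun_eq:
  assumes \<Omega>: "\<Omega> \<in> sets lebesgue" "emeasure lebesgue \<Omega> < \<infinity>"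
    and T: "admissible_target \<Omega> rmax T" and r: "0 \<le> r" "0 \<le> rmax"
  shows "dist_fun \<Omega> rmax T r = (pi * area T + min r rmax * perimeter T) / (pi * measure lebesgue \<Omega>)"
proof -
  interpret L: sigma_finite_measure "lebesgue :: (real \<times> real) measure"
    by (rule sigma_finite_lebesgue)
  interpret P: pair_sigma_finite "lebesgue :: (real \<times> real) measure" "lborel :: real measure" ..
  let ?M = "lebesgue \<Otimes>\<^sub>M lborel :: ((real \<times> real) \<times> real) measure"
  define \<rho> where "\<rho> = min r rmax"
  define X where "X = {(p, \<theta>). p \<in> sweep \<rho> (cos \<theta>, sin \<theta>) T}"
  have \<rho>: "0 \<le> \<rho>" "\<rho> \<le> rmax" using r by (auto simp: \<rho>_def)
  have cp: "convex_polygon T" and sub: "T \<subseteq> \<Omega>" and nb: "{q. infdist q T \<le> rmax} \<subseteq> \<Omega>"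
    using T by (auto simp: admissible_target_def)
  have cT: "compact T"
    using cp by (simp add: convex_polygon_def polytope_imp_compact)
  have fm: "\<Omega> \<in> lmeasurable"
    using \<Omega> by (auto simp: fmeasurable_def)
  have pos: "measure lebesgue \<Omega> > 0"
    by (rule admissible_target_imp_measure_pos[OF fm T])
  \<comment> \<open>A position that reaches \<open>T\<close> by time \<rho> at unit speed is within
    \<open>rmax\<close> of \<open>T\<close>, so the margin around \<open>T\<close> contains it;
    intersecting with \<Omega> cuts nothing off the sweep.\<close>
  have in\<Omega>: "sweep \<rho> (cos \<theta>, sin \<theta>) T \<subseteq> \<Omega>" for \<theta>
  proof
    fix p assume "p \<in> sweep \<rho> (cos \<theta>, sin \<theta>) T"
    then obtain t where t: "0 \<le> t" "t \<le> \<rho>" "p + t *\<^sub>R (cos \<theta>, sin \<theta>) \<in> T" by (auto simp: sweep_def)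
    have "infdist p T \<le> dist p (p + t *\<^sub>R (cos \<theta>, sin \<theta>))"
      using t(3) by (rule infdist_le)
    also have "\<dots> = t"
      using t(1) by (simp add: dist_norm norm_prod_def power_mult_distrib flip: distrib_left)
    finally show "p \<in> \<Omega>" using t \<rho> nb by auto
  qed
  \<comment> \<open>\<open>X\<close> is Borel, whereas the first factor of \<open>?M\<close> carries
    the Lebesgue sets; the identity from \<open>?M\<close> to the Borel product is measurable and
    pulls \<open>X\<close> back.\<close>
  have Xb: "X \<in> sets ?M"
  proof -
    have "(\<lambda>x. x) \<in> (lebesgue :: (real \<times> real) measure) \<rightarrow>\<^sub>M borel"
      by (simp add: measurable_completion)
    from measurable_compose[OF measurable_fst this]
    have "(\<lambda>z. (fst z, snd z)) \<in> ?M \<rightarrow>\<^sub>M borel \<Otimes>\<^sub>M borel"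
      by (intro measurable_Pair) auto
    from measurable_sets[OF this, of X] show ?thesis
      using sweep_graph_borel[OF cT, of \<rho>] unfolding X_def[symmetric] borel_prod
      by (simp add: space_pair_measure)
  qed
  have D: "\<Omega> \<times> {0..<2 * pi} \<in> sets ?M"
    using \<Omega> by (intro pair_measureI) auto
  have "emeasure ?M (\<Omega> \<times> {0..<2 * pi}) = emeasure lebesgue \<Omega> * ennreal (2 * pi)"
    using \<Omega>(1) by (subst lborel.emeasure_pair_measure_Times) auto
  also have "emeasure lebesgue \<Omega> = ennreal (measure lebesgue \<Omega>)"
    using fm by (rule emeasure_eq_measure2)
  finally have eD: "emeasure ?M (\<Omega> \<times> {0..<2 * pi}) = ennreal (measure lebesgue \<Omega> * (2 * pi))"
    by (simp add: ennreal_mult)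
  have "emeasure ?M (\<Omega> \<times> {0..<2 * pi} \<inter> X)
      = (\<integral>\<^sup>+\<theta>. emeasure lebesgue ((\<lambda>p. (p, \<theta>)) -` (\<Omega> \<times> {0..<2 * pi} \<inter> X)) \<partial>lborel)"
    using D Xb by (intro P.emeasure_pair_measure_alt2) auto
  \<comment> \<open>The half-open range of angles and the closed interval of integration differ only
    in \<open>2 * pi\<close>, a null set.\<close>
  also have "\<dots> = (\<integral>\<^sup>+\<theta>. ennreal (measure lebesgue (sweep \<rho> (cos \<theta>, sin \<theta>) T)) * indicator {0..2 * pi} \<theta> \<partial>lborel)"
  proof (rule nn_integral_cong_AE)
    have slice: "(\<lambda>p. (p, \<theta>)) -` (\<Omega> \<times> {0..<2 * pi} \<inter> X)
        = (if \<theta> \<in> {0..<2 * pi} then sweep \<rho> (cos \<theta>, sin \<theta>) T else {})" for \<theta>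
      using in\<Omega>[of \<theta>] by (auto simp: X_def)
    have fin: "emeasure lebesgue (sweep \<rho> (cos \<theta>, sin \<theta>) T)
        = ennreal (measure lebesgue (sweep \<rho> (cos \<theta>, sin \<theta>) T))" for \<theta>
      using cT by (intro emeasure_eq_measure2 lmeasurable_compact compact_sweep)
    show "AE \<theta> in lborel. emeasure lebesgue ((\<lambda>p. (p, \<theta>)) -` (\<Omega> \<times> {0..<2 * pi} \<inter> X))
        = ennreal (measure lebesgue (sweep \<rho> (cos \<theta>, sin \<theta>) T)) * indicator {0..2 * pi} \<theta>"
      using AE_lborel_singleton[of "2 * pi"]
      unfolding slice by eventually_elim (auto simp: fin indicator_def)
  qed
  also have "\<dots> = ennreal (2 * pi * area T + 2 * \<rho> * perimeter T)"
    by (intro nn_integral_has_integral_lebesgue' integral_area_sweep cp \<rho>) simp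
  finally have eX: "emeasure ?M (\<Omega> \<times> {0..<2 * pi} \<inter> X) = ennreal (2 * pi * area T + 2 * \<rho> * perimeter T)" .
  have "0 \<le> perimeter T"
  proof -
    have "bounded E" if "E face_of T" for E
      using that by (intro bounded_subset[OF compact_imp_bounded[OF cT]] face_of_imp_subset)
    then show ?thesis unfolding perimeter_def by (intro sum_nonneg diameter_ge_0) auto
  qed
  then have nn: "0 \<le> 2 * pi * area T + 2 * \<rho> * perimeter T"
    using \<rho> by (simp add: area_def)
  have "dist_fun \<Omega> rmax T r = measure (uniform_measure ?M (\<Omega> \<times> {0..<2 * pi})) X"
    unfolding dist_fun_def sensor_space_def X_def \<rho>_def Inf_hit_times_le_iff[OF cT] ..
  also have "\<dots> = measure ?M (\<Omega> \<times> {0..<2 * pi} \<inter> X) / measure ?M (\<Omega> \<times> {0..<2 * pi})"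
    using pos Xb by (intro measure_uniform_measure) (auto simp: eD)
  also have "\<dots> = (2 * pi * area T + 2 * \<rho> * perimeter T) / (measure lebesgue \<Omega> * (2 * pi))"
    using nn pos by (simp add: measure_def eD eX)
  also have "\<dots> = (pi * area T + \<rho> * perimeter T) / (pi * measure lebesgue \<Omega>)"
    using pos by (simp add: field_simps)
  finally show ?thesis unfolding \<rho>_def .
qed

text \<open>Handles the negative radii that the finite set in \<open>observable\<close> may contain:
  hit times are never negative, so the event is empty.\<close>

lemma dist_fun_neg:
  assumes "r < 0"
  shows "dist_fun \<Omega> rmax T r = 0"
proof -
  have "\<not> (hit_times rmax T p \<theta> \<noteq> {} \<and> Inf (hit_times rmax T p \<theta>) \<le> r)" for p \<theta>
  proof
    assume H: "hit_times rmax T p \<theta> \<noteq> {} \<and> Inf (hit_times rmax T p \<theta>) \<le> r"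
    have "0 \<le> t" if "t \<in> hit_times rmax T p \<theta>" for t
      using that by (simp add: hit_times_def)
    then have "0 \<le> Inf (hit_times rmax T p \<theta>)"
      using H by (intro cInf_greatest) auto
    then show False using H assms by linarith
  qed
  then have "{(p, \<theta>). hit_times rmax T p \<theta> \<noteq> {} \<and> Inf (hit_times rmax T p \<theta>) \<le> r} = {}"
    by blast
  then show ?thesis unfolding dist_fun_def by (simp only: measure_empty)
qed

section \<open>The criterion for observability\<close>

text \<open>By \<open>dist_fun_eq\<close> and \<open>dist_fun_neg\<close> the whole distribution
  function depends on the target through perimeter and area only; conversely, two radii recover
  both.\<close>

lemma observable_iff:
  fixes f :: "(real \<times> real) set \<Rightarrow> 'b"
  assumes \<Omega>: "\<Omega> \<in> sets lebesgue" "emeasure lebesgue \<Omega> < \<infinity>" and rmax: "rmax > 0"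
    and C_sub: "C \<subseteq> {T. admissible_target \<Omega> rmax T}"
  shows "observable \<Omega> rmax C f \<longleftrightarrow>
    (\<forall>T1\<in>C. \<forall>T2\<in>C. perimeter T1 = perimeter T2 \<and> area T1 = area T2 \<longrightarrow> f T1 = f T2)"
proof
  have C: "admissible_target \<Omega> rmax T" if "T \<in> C" for T
    using that C_sub by blast
  assume "observable \<Omega> rmax C f"
  moreover have "dist_fun \<Omega> rmax T1 r = dist_fun \<Omega> rmax T2 r"
    if "T1 \<in> C" "T2 \<in> C" "perimeter T1 = perimeter T2" "area T1 = area T2" for T1 T2 r
    using that rmax dist_fun_eq[OF \<Omega> C, of _ r] dist_fun_neg[of r]
    by (cases "r < 0") auto
  ultimately show "\<forall>T1\<in>C. \<forall>T2\<in>C. perimeter T1 = perimeter T2 \<and> area T1 = area T2 \<longrightarrow> f T1 = f T2"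
    unfolding observable_def by metis
next
  have C: "admissible_target \<Omega> rmax T" if "T \<in> C" for T
    using that C_sub by blast
  assume f: "\<forall>T1\<in>C. \<forall>T2\<in>C. perimeter T1 = perimeter T2 \<and> area T1 = area T2 \<longrightarrow> f T1 = f T2"
  \<comment> \<open>At radius \<open>0\<close> the perimeter term drops out and the value gives the
    area; the value at \<open>rmax > 0\<close> then gives the perimeter.\<close>
  have "perimeter T1 = perimeter T2 \<and> area T1 = area T2"
    if T: "T1 \<in> C" "T2 \<in> C" and eq: "\<forall>r\<in>{0, rmax}. dist_fun \<Omega> rmax T1 r = dist_fun \<Omega> rmax T2 r" for T1 T2
  proof -
    have "measure lebesgue \<Omega> > 0"
      using \<Omega> by (intro admissible_target_imp_measure_pos[OF _ C[OF T(1)]]) (auto simp: fmeasurable_def)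
    then have "area T1 = area T2"
      using eq dist_fun_eq[OF \<Omega> C, of _ 0] T rmax by simp
    moreover have "pi * area T1 + rmax * perimeter T1 = pi * area T2 + rmax * perimeter T2"
      using eq dist_fun_eq[OF \<Omega> C, of _ rmax] T rmax \<open>measure lebesgue \<Omega> > 0\<close> by simp
    ultimately show ?thesis using rmax by simp
  qed
  with f show "observable \<Omega> rmax C f"
    unfolding observable_def by (intro exI[of _ "{0, rmax}"]) blast
qed

theorem theorem3:
  fixes \<Omega> :: "(real \<times> real) set" and rmax :: real
  assumes "\<Omega> \<in> sets lebesgue" and "emeasure lebesgue \<Omega> < \<infinity>" and "rmax > 0"
  defines "C \<equiv> {T. admissible_target \<Omega> rmax T}"
  shows "observable \<Omega> rmax C perimeter \<and> observable \<Omega> rmax C area \<and>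
    (\<forall>f :: (real \<times> real) set \<Rightarrow> 'b. observable \<Omega> rmax C f \<longleftrightarrow>
       (\<forall>T1\<in>C. \<forall>T2\<in>C. perimeter T1 = perimeter T2 \<and> area T1 = area T2 \<longrightarrow> f T1 = f T2))"
proof -
  have C: "C \<subseteq> {T. admissible_target \<Omega> rmax T}"
    by (simp add: C_def)
  \<comment> \<open>For \<open>perimeter\<close> and \<open>area\<close> the right-hand side of the
    criterion holds trivially, so one rewriting settles all three claims.\<close>
  show ?thesis
    unfolding observable_iff[OF assms(1-3) C] by simp
qed

end
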